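(* The subshift $\overline{\{S^n\eta:n\in\mathbb{N}^*\}}$ generated by $\eta$ (closure in the product topology of $X$) coincides with the subshift $X_{\mathscr{B}}$ of $\mathscr{B}$-admissible sequences.
   Context: $\mathbb{N}^*=\{1,2,3,\ldots\}$. $\mathscr{B}=\{b_k:k\ge1\}\subset\{2,3,4,\ldots\}$ is a given infinite set of pairwise relatively prime integers with $\sum_{k\ge1}1/b_k<\infty$. $X=\{0,1\}^{\mathbb{N}^*}$ with the product topology, and $S:X\to X$ is the shift, $(Sx)_n=x_{n+1}$. The sequence $\eta=(\eta_n)_{n\in\mathbb{N}^*}\in X$ is defined by $\eta_n=0$ if some $b_k$ divides $n$, and $\eta_n=1$ otherwise. For $A\subset\mathbb{N}^*$ and $b\ge1$, $t(A,b)$ is the number of residue classes modulo $b$ containing an element of $A$. $A$ is $\mathscr{B}$-admissible if $t(A,b_k)<b_k$ for all $k\ge1$. A sequence $x\in X$ is $\mathscr{B}$-admissible if $\{n\in\mathbb{N}^*:x_n=1\}$ is. $X_{\mathscr{B}}$ is the set of $\mathscr{B}$-admissible sequences in $X$. *)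

theory Defs
  imports "HOL-Analysis.Analysis" "HOL-Number_Theory.Cong"
begin

text \<open>
  The index set of all sequences is \<open>{1..}\<close>, the positive naturals. A 0-1 sequence is an
  extensional function on \<open>{1..}\<close> (undefined at index 0), so that the space of all of them is
  the topological space \<open>binary_seq_top\<close>, with carrier \<open>{1..} \<rightarrow>\<^sub>E {0, 1}\<close>.
\<close>

definition binary_seq_top :: "(nat \<Rightarrow> nat) topology" where
  "binary_seq_top = product_topology (\<lambda>_. discrete_topology {0, 1}) {1..}"

lemma topspace_binary_seq_top: "topspace binary_seq_top = {1..} \<rightarrow>\<^sub>E {0, 1}"
  by (simp add: binary_seq_top_def)

definition shift :: "(nat \<Rightarrow> nat) \<Rightarrow> (nat \<Rightarrow> nat)" where
  "shift x = (\<lambda>n\<in>{1..}. x (n + 1))"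

definition eta :: "nat set \<Rightarrow> nat \<Rightarrow> nat" where
  "eta B = (\<lambda>n\<in>{1..}. if \<exists>b\<in>B. b dvd n then 0 else 1)"

text \<open>Residue classes modulo \<open>b\<close> are represented by \<open>0, \<dots>, b - 1\<close>.\<close>

definition residue_count :: "nat set \<Rightarrow> nat \<Rightarrow> nat" where
  "residue_count A b = card {r \<in> {0..<b}. \<exists>a\<in>A. [a = r] (mod b)}"

definition admissible_set :: "nat set \<Rightarrow> nat set \<Rightarrow> bool" where
  "admissible_set B A \<longleftrightarrow> A \<subseteq> {1..} \<and> (\<forall>b\<in>B. residue_count A b < b)"

definition admissible_seqs :: "nat set \<Rightarrow> (nat \<Rightarrow> nat) set" where
  "admissible_seqs B =
     {x \<in> topspace binary_seq_top. admissible_set B {n \<in> {1..}. x n = 1}}"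

end

theory Submission
  imports Defs
begin

text \<open>
  Elements of the closure are admissible because each residue class condition only involves
  finitely many coordinates. Conversely, let \<open>x\<close> be admissible and \<open>N\<close> given; we need a shift
  \<open>n \<ge> 1\<close> with \<open>\<eta>\<^sub>n\<^sub>+\<^sub>j = x\<^sub>j\<close> for \<open>1 \<le> j \<le> N\<close>. Each \<open>j\<close> with \<open>x\<^sub>j = 0\<close> gets its own \<open>b > N\<close> in \<open>B\<close>
  and the congruence \<open>n \<equiv> -j\<close> modulo \<open>b\<close>; as \<open>b > N\<close>, this \<open>b\<close> divides no other \<open>n + i\<close>. For the
  remaining \<open>b\<close> in a large finite subset \<open>F\<close> of \<open>B\<close>, let \<open>n \<equiv> -r\<close> modulo \<open>b\<close> where \<open>r\<close> is a residue
  missed by \<open>{i. x\<^sub>i = 1}\<close>. By the Chinese remainder theorem these congruences define a progression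
  modulo \<open>\<Prod>F\<close>. Its members \<open>n\<close> for which some \<open>n + i\<close> with \<open>x\<^sub>i = 1\<close> is divisible by some \<open>b\<close>
  outside \<open>F\<close> have relative density at most \<open>N\<close> times the tail sum of \<open>1/b\<close>, which is less than 1.
\<close>

section \<open>Tails and sparseness of sets with summable reciprocals\<close>

lemma summable_on_nonneg_tail:
  fixes f :: "'a \<Rightarrow> real"
  assumes f: "f summable_on B" and nonneg: "\<And>b. b \<in> B \<Longrightarrow> 0 \<le> f b" and "e > 0"
  obtains F where "finite F" "F \<subseteq> B" "\<And>G. finite G \<Longrightarrow> G \<subseteq> B - F \<Longrightarrow> sum f G \<le> e"
proof -
  obtain F where F: "finite F" "F \<subseteq> B" "dist (sum f F) (infsum f B) \<le> e"
    using infsum_finite_approximation[OF f \<open>e > 0\<close>] by blast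
  have "sum f G \<le> e" if G: "finite G" "G \<subseteq> B - F" for G
  proof -
    have "sum f F + sum f G = sum f (F \<union> G)"
      using F G by (intro sum.union_disjoint[symmetric]) auto
    also have "\<dots> \<le> infsum f B"
      using F G nonneg by (intro finite_sum_le_infsum f) auto
    finally show ?thesis
      using F(3) by (simp add: dist_real_def)
  qed
  with F show thesis
    using that by blast
qed

text \<open>Outside a finite \<open>F\<close> with small tail, each \<open>b \<le> x\<close>
  contributes \<open>x / b \<ge> 1\<close>, so there are at most \<open>e * x\<close> of them. This
  controls the rounding errors of the sieve below, one for each \<open>b\<close>.\<close>

lemma reciprocals_summable_imp_sparse:
  fixes B :: "nat set"
  assumes "(\<lambda>b. 1 / real b) summable_on B" and pos: "0 \<notin> B" and "e > 0"
  shows "\<exists>K. \<forall>x. real (card {b \<in> B. b \<le> x}) \<le> K + e * real x"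
proof -
  obtain F where F: "finite F" "F \<subseteq> B"
      "\<And>G. finite G \<Longrightarrow> G \<subseteq> B - F \<Longrightarrow> (\<Sum>b\<in>G. 1 / real b) \<le> e"
    using summable_on_nonneg_tail[OF assms(1) _ \<open>e > 0\<close>]
    by (metis divide_nonneg_nonneg of_nat_0_le_iff zero_le_one)
  have "real (card {b \<in> B. b \<le> x}) \<le> real (card F) + e * real x" for x
  proof -
    let ?G = "{b \<in> B - F. b \<le> x}"
    have fin: "finite ?G"
      by (rule finite_subset[of _ "{..x}"]) auto
    have "card {b \<in> B. b \<le> x} \<le> card (F \<union> ?G)"
      using F(1) fin by (intro card_mono) auto
    also have "\<dots> \<le> card F + card ?G"
      by (rule card_Un_le)
    finally have "real (card {b \<in> B. b \<le> x}) \<le> real (card F) + real (card ?G)"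
      by linarith
    moreover have "real (card ?G) = (\<Sum>b\<in>?G. 1)"
      by simp
    moreover have "(\<Sum>b\<in>?G. 1 :: real) \<le> (\<Sum>b\<in>?G. real x * (1 / real b))"
    proof (rule sum_mono)
      fix b assume "b \<in> ?G"
      moreover from this pos have "b > 0" by (metis Diff_iff mem_Collect_eq not_gr_zero)
      ultimately show "1 \<le> real x * (1 / real b)" by (simp add: field_simps)
    qed
    moreover have "(\<Sum>b\<in>?G. real x * (1 / real b)) \<le> real x * e"
      unfolding sum_distrib_left[symmetric] using fin F(3)[of ?G] by (intro mult_left_mono) auto
    ultimately show ?thesis
      by (simp add: mult.commute)
  qed
  then show ?thesis
    by blast
qed

section \<open>Sieving an arithmetic progression\<close>

text \<open>As \<open>M\<close> is invertible modulo \<open>b\<close>, all solutions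
  \<open>t\<close> lie in one residue class, so \<open>t div b\<close> determines
  \<open>t\<close>.\<close>

lemma card_dvd_progression_le:
  fixes a b M T :: nat
  assumes "coprime M b" "b > 0"
  shows "real (card {t \<in> {1..T}. b dvd a + M * t}) \<le> real T / real b + 1"
proof -
  let ?S = "{t \<in> {1..T}. b dvd a + M * t}"
  have "inj_on (\<lambda>t. t div b) ?S"
  proof (rule inj_onI)
    fix s t assume s: "s \<in> ?S" and t: "t \<in> ?S" and eq: "s div b = t div b"
    have "[a + M * s = a + M * t] (mod b)"
      using s t by (simp add: cong_def dvd_eq_mod_eq_0)
    then have "[M * s = M * t] (mod b)"
      by (simp add: cong_add_lcancel_nat)
    then have "[s = t] (mod b)"
      using assms(1) by (simp add: cong_mult_lcancel_nat)
    with eq show "s = t"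
      unfolding cong_def by (metis div_mult_mod_eq)
  qed
  then have "card ?S = card ((\<lambda>t. t div b) ` ?S)"
    by (simp add: card_image)
  also have "\<dots> \<le> card {0..T div b}"
    by (intro card_mono) (auto intro: div_le_mono)
  finally have "real (card ?S) \<le> real (T div b) + 1"
    by simp
  also have "\<dots> \<le> real T / real b + 1"
    using of_nat_div_le_of_nat[of T b] by simp
  finally show ?thesis .
qed

text \<open>If every \<open>t \<le> T\<close> failed, a union bound over \<open>i\<close> and
  \<open>b\<close> would give \<open>T \<le> card A * (T * s + E)\<close>, where \<open>E\<close>
  counts the \<open>b\<close> that are small enough to divide. By sparseness \<open>E\<close> is at
  most a constant plus a small multiple of \<open>T\<close>, which is impossible for large
  \<open>T\<close>.\<close>

lemma sieve_progression:
  fixes B A :: "nat set" and c M :: nat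
  assumes summable: "(\<lambda>b. 1 / real b) summable_on B" and pos: "0 \<notin> B"
    and cop: "\<And>b. b \<in> B \<Longrightarrow> coprime M b"
    and tail: "\<And>G. finite G \<Longrightarrow> G \<subseteq> B \<Longrightarrow> (\<Sum>b\<in>G. 1 / real b) \<le> s"
    and A: "finite A" "real (card A) * s < 1"
  obtains t where "t \<ge> 1" "\<And>i b. i \<in> A \<Longrightarrow> b \<in> B \<Longrightarrow> \<not> b dvd c + M * t + i"
proof (rule ccontr)
  assume *: "\<not> thesis"
  \<comment> \<open>\<open>d\<close> is the margin left by the main term. \<open>e\<close> is chosen
    so that the rounding errors use up at most half of it; the summand 1 in \<open>P\<close> only
    avoids division by zero.\<close>
  define d where "d = 1 - real (card A) * s"
  define P where "P = real (card A) * real M + 1"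
  define e where "e = d / (2 * P)"
  have "d > 0" using A by (simp add: d_def)
  have "P > 0"
    by (simp add: P_def add_nonneg_pos)
  have "e > 0" using \<open>d > 0\<close> \<open>P > 0\<close> by (simp add: e_def)
  have "real (card A) * real M * e \<le> P * e"
    using \<open>e > 0\<close> by (intro mult_right_mono) (auto simp: P_def)
  also have "\<dots> = d / 2"
    using \<open>P > 0\<close> by (simp add: e_def)
  finally have e: "real (card A) * real M * e \<le> d / 2" .
  obtain K where K: "\<And>x. real (card {b \<in> B. b \<le> x}) \<le> K + e * real x"
    using reciprocals_summable_imp_sparse[OF summable pos \<open>e > 0\<close>] by metis
  obtain m where m: "\<And>i. i \<in> A \<Longrightarrow> i \<le> m"
    using A(1) by (auto simp: finite_nat_set_iff_bounded_le)
  have bound: "real T * (d / 2) \<le> real (card A) * (K + e * real (c + m))" for T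
  proof -
    define X where "X = c + M * T + m"
    let ?G = "{b \<in> B. b \<le> X}"
    let ?S = "\<lambda>i b. {t \<in> {1..T}. b dvd c + i + M * t}"
    have fin: "finite ?G"
      by (rule finite_subset[of _ "{..X}"]) auto
    have "{1..T} \<subseteq> (\<Union>i\<in>A. \<Union>b\<in>?G. ?S i b)"
    proof
      fix t assume t: "t \<in> {1..T}"
      with * that obtain i b where ib: "i \<in> A" "b \<in> B" "b dvd c + M * t + i"
        by (metis atLeastAtMost_iff)
      \<comment> \<open>Every \<open>b\<close> divides 0, so positivity is needed to get
        \<open>b \<le> X\<close> and thus a finite union.\<close>
      have "c + M * t + i > 0"
      proof (rule ccontr)
        assume "\<not> ?thesis"
        \<comment> \<open>Then \<open>M = 0\<close>, so that every element of \<open>B\<close> is 1 and \<open>1 \<in> B\<close> forces \<open>s \<ge> 1\<close>.\<close>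
        then have "M = 0" using t by auto
        with cop[OF ib(2)] have "b = 1" by simp
        with tail[of "{1}"] ib(2) have "s \<ge> 1" by simp
        moreover have "card A \<ge> 1" using A(1) ib(1) by (metis One_nat_def Suc_leI card_gt_0_iff empty_iff)
        ultimately have "1 * 1 \<le> real (card A) * s" by (intro mult_mono) auto
        with A(2) show False by simp
      qed
      then have "b \<le> c + M * t + i"
        using ib(3) by (simp add: dvd_imp_le)
      also have "\<dots> \<le> X"
        unfolding X_def using m[OF ib(1)] t by (intro add_mono mult_left_mono) auto
      finally have "b \<in> ?G"
        using ib(2) by simp
      moreover have "t \<in> ?S i b"
        using ib(3) t by (simp add: add_ac)
      ultimately show "t \<in> (\<Union>i\<in>A. \<Union>b\<in>?G. ?S i b)"
        using ib(1) by blast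
    qed
    then have "card {1..T} \<le> card (\<Union>i\<in>A. \<Union>b\<in>?G. ?S i b)"
      using A(1) fin by (intro card_mono) auto
    also have "\<dots> \<le> (\<Sum>i\<in>A. card (\<Union>b\<in>?G. ?S i b))"
      by (rule card_UN_le[OF A(1)])
    also have "\<dots> \<le> (\<Sum>i\<in>A. \<Sum>b\<in>?G. card (?S i b))"
      by (intro sum_mono card_UN_le fin)
    finally have "real T \<le> real (\<Sum>i\<in>A. \<Sum>b\<in>?G. card (?S i b))"
      by (simp only: of_nat_le_iff card_atLeastAtMost diff_Suc_1)
    also have "\<dots> = (\<Sum>i\<in>A. \<Sum>b\<in>?G. real (card (?S i b)))"
      by simp
    also have "\<dots> \<le> (\<Sum>i\<in>A. \<Sum>b\<in>?G. real T / real b + 1)"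
      using pos cop by (intro sum_mono card_dvd_progression_le) (auto intro!: Nat.gr0I)
    also have "\<dots> = real (card A) * (real T * (\<Sum>b\<in>?G. 1 / real b) + real (card ?G))"
      by (simp add: sum.distrib sum_distrib_left)
    also have "\<dots> \<le> real (card A) * (real T * s + (K + e * real X))"
      using fin tail[of ?G] K[of X] by (intro mult_left_mono add_mono) auto
    \<comment> \<open>The part of \<open>e * X\<close> that grows with \<open>T\<close> is split
      off, to be absorbed by half of \<open>d\<close>.\<close>
    finally have "real T * d \<le> real (card A) * (K + e * real (c + m)) + real T * (real (card A) * real M * e)"
      by (simp add: X_def d_def algebra_simps)
    moreover have "real T * (real (card A) * real M * e) \<le> real T * (d / 2)"
      using e by (intro mult_left_mono) auto
    ultimately show ?thesis by simp
  qed
  obtain T :: nat where "real (card A) * (K + e * real (c + m)) < real T * (d / 2)"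
    using \<open>d > 0\<close> reals_Archimedean3[of "d / 2"] by auto
  with bound[of T] show False by simp
qed

section \<open>Finding an admissible pattern in \<open>eta B\<close>\<close>

lemma admissible_set_missed_residue:
  assumes "admissible_set B A" "b \<in> B"
  obtains r where "r < b" "\<And>a. a \<in> A \<Longrightarrow> \<not> [a = r] (mod b)"
proof -
  let ?R = "{r \<in> {0..<b}. \<exists>a\<in>A. [a = r] (mod b)}"
  have "card ?R < card {0..<b}"
    using assms by (simp add: admissible_set_def residue_count_def)
  then have "?R \<noteq> {0..<b}"
    by (metis less_irrefl)
  then obtain r where "r \<in> {0..<b}" "r \<notin> ?R"
    by blast
  then show thesis
    using that[of r] by simp
qed

lemma admissible_pattern_occurs:
  fixes B A :: "nat set"
  assumes inf: "infinite B" and B2: "B \<subseteq> {2..}" and cop: "pairwise coprime B"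
    and summable: "(\<lambda>b. 1 / real b) summable_on B"
    and adm: "admissible_set B A"
  obtains n where "n \<ge> 1" "\<And>j. j \<in> {1..N} \<Longrightarrow> (\<exists>b\<in>B. b dvd n + j) \<longleftrightarrow> j \<notin> A"
proof -
  have "infinite (B - {..N})"
    using inf by simp
  then obtain Q where Q: "finite Q" "card Q = N" "Q \<subseteq> B - {..N}"
    using infinite_arbitrarily_large by blast
  then obtain g where g: "bij_betw g {1..N} Q"
    by (metis card_atLeastAtMost diff_Suc_1 finite_atLeastAtMost finite_same_card_bij)
  define C where "C = {1..N} - A"
  define h where "h = inv_into {1..N} g"
  \<comment> \<open>At most \<open>N\<close> positions carry a 1, and \<open>N / (N + 1) < 1\<close>
    is what the sieve requires.\<close>
  obtain F0 where F0: "finite F0" "F0 \<subseteq> B"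
      "\<And>G. finite G \<Longrightarrow> G \<subseteq> B - F0 \<Longrightarrow> (\<Sum>b\<in>G. 1 / real b) \<le> 1 / (real N + 1)"
    using summable_on_nonneg_tail[OF summable, of "1 / (real N + 1)"] by auto
  define F where "F = F0 \<union> g ` C"
  have gB: "g j \<in> B" "g j > N" if "j \<in> {1..N}" for j
  proof -
    have "g j \<in> B - {..N}"
      using bij_betwE[OF g] Q(3) that by blast
    then show "g j \<in> B" "g j > N" by auto
  qed
  have F: "finite F" "F \<subseteq> B"
    using F0 gB by (auto simp: F_def C_def)
  have "\<exists>r. \<forall>a\<in>A. \<not> [a = r] (mod b)" if "b \<in> B" for b
    using admissible_set_missed_residue[OF adm that] by metis
  then obtain r where r: "\<And>b a. b \<in> B \<Longrightarrow> a \<in> A \<Longrightarrow> \<not> [a = r b] (mod b)"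
    by metis
  \<comment> \<open>\<open>n\<close> will be congruent to \<open>- v b\<close> modulo
    \<open>b\<close>, written as \<open>(b - 1) * v b\<close> to stay in the naturals. So
    \<open>b\<close> divides \<open>n + a\<close> exactly for \<open>a\<close> in the class of
    \<open>v b\<close>: a position to be made 0, or a class that misses \<open>A\<close>.\<close>
  define v where "v = (\<lambda>b. if b \<in> g ` C then h b else r b)"
  have "\<exists>c. \<forall>b\<in>F. [c = (b - 1) * v b] (mod b)"
    using F cop by (intro chinese_remainder_nat) (auto simp: pairwise_def)
  then obtain c where c: "\<And>b. b \<in> F \<Longrightarrow> [c = (b - 1) * v b] (mod b)"
    by blast
  have copF: "coprime (\<Prod>F) b" if "b \<in> B - F" for b
    using that F cop by (intro prod_coprime_left) (metis Diff_iff pairwiseD subsetD)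
  have "real (card (A \<inter> {1..N})) * (1 / (real N + 1)) < 1"
    using card_mono[of "{1..N}" "A \<inter> {1..N}"] by simp
  moreover have "(\<lambda>b. 1 / real b) summable_on (B - F)"
    using summable by (rule summable_on_subset) auto
  moreover have "0 \<notin> B - F"
    using B2 by auto
  moreover have "(\<Sum>b\<in>G. 1 / real b) \<le> 1 / (real N + 1)" if "finite G" "G \<subseteq> B - F" for G
    using that by (intro F0(3)) (auto simp: F_def)
  ultimately obtain t where t: "t \<ge> 1"
      "\<And>i b. i \<in> A \<inter> {1..N} \<Longrightarrow> b \<in> B - F \<Longrightarrow> \<not> b dvd c + \<Prod>F * t + i"
    using sieve_progression[of "B - F" "\<Prod>F" "1 / (real N + 1)" "A \<inter> {1..N}" c] copF
    by (metis finite_Int finite_atLeastAtMost)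
  define n where "n = c + \<Prod>F * t"
  have "\<Prod>F > 0"
    using F B2 by (intro prod_pos) force
  then have n: "n \<ge> 1"
    using t(1) by (simp add: n_def Suc_le_eq)
  have dvd_v: "b dvd n + v b" if b: "b \<in> F" for b
  proof -
    have "b > 0" using b F B2 by fastforce
    have "[n = c] (mod b)"
      using dvd_prodI[OF F(1) b, of id]
      by (simp add: n_def cong_def mod_add_right_eq[symmetric, of c] dvd_imp_mod_0)
    then have "[n + v b = (b - 1) * v b + v b] (mod b)"
      using c[OF b] by (meson cong_add_rcancel_nat cong_trans)
    also have "(b - 1) * v b + v b = b * v b"
      using \<open>b > 0\<close> by (cases b) auto
    finally show ?thesis
      by (metis cong_dvd_iff dvd_triv_left)
  qed
  have dvd_iff: "b dvd n + a \<longleftrightarrow> [a = v b] (mod b)" if b: "b \<in> F" for a b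
  proof -
    have "b dvd n + a \<longleftrightarrow> [n + a = n + v b] (mod b)"
      using dvd_v[OF b] by (simp add: cong_def dvd_eq_mod_eq_0)
    then show ?thesis by (simp add: cong_add_lcancel_nat)
  qed
  have vg: "v (g j) = j" if "j \<in> C" for j
    using that g by (auto simp: v_def h_def C_def bij_betw_def)
  have "(\<exists>b\<in>B. b dvd n + j) \<longleftrightarrow> j \<notin> A" if j: "j \<in> {1..N}" for j
  proof
    assume "j \<notin> A"
    with j have "g j dvd n + j"
      using dvd_v[of "g j"] vg[of j] by (simp add: F_def C_def)
    with gB j show "\<exists>b\<in>B. b dvd n + j" by blast
  next
    assume "\<exists>b\<in>B. b dvd n + j"
    then obtain b where b: "b \<in> B" "b dvd n + j" by blast
    show "j \<notin> A"
    proof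
      assume "j \<in> A"
      with t(2)[of j b] b j have "b \<in> F" by (auto simp: n_def)
      with b have cong: "[j = v b] (mod b)" using dvd_iff by simp
      show False
      proof (cases "b \<in> g ` C")
        case True
        then obtain i where i: "i \<in> C" "b = g i" by blast
        with cong vg have "[j = i] (mod b)" by simp
        \<comment> \<open>Here \<open>b > N\<close> is used: congruent positions in the window
          coincide.\<close>
        moreover have "j < b" "i < b" using i gB[of i] j by (auto simp: C_def)
        ultimately have "j = i" by (simp add: cong_def)
        with i \<open>j \<in> A\<close> show False by (simp add: C_def)
      next
        case False
        with cong r[OF b(1) \<open>j \<in> A\<close>] show False by (simp add: v_def)
      qed
    qed
  qed
  with n that show thesis by blast
qed

section \<open>Shifts of \<open>eta B\<close> and closure in terms of initial segments\<close>

lemma shift_funpow_eta: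
  "(shift ^^ n) (eta B) = (\<lambda>k\<in>{1..}. if \<exists>b\<in>B. b dvd n + k then 0 else 1)"
proof (induction n)
  case 0
  show ?case by (simp add: eta_def)
next
  case (Suc n)
  then show ?case by (auto simp: shift_def fun_eq_iff)
qed

lemma openin_binary_seq_top_cylinder:
  "openin binary_seq_top {y \<in> topspace binary_seq_top. \<forall>k\<in>{1..N}. y k = x k}"
proof -
  \<comment> \<open>\<open>x\<close> need not be a 0-1 sequence; intersecting with
    \<open>{0, 1}\<close> keeps each factor open in the discrete space, and it may be empty.\<close>
  let ?U = "\<lambda>k. if k \<in> {1..N} then {x k} \<inter> {0, 1} else {0, 1}"
  have "{y \<in> topspace binary_seq_top. \<forall>k\<in>{1..N}. y k = x k} = Pi\<^sub>E {1..} ?U"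
    unfolding topspace_binary_seq_top by (auto simp: PiE_iff extensional_def split: if_splits)
  moreover have "finite {k \<in> {1..}. ?U k \<noteq> {0, 1}}"
    by (rule finite_subset[of _ "{1..N}"]) auto
  ultimately show ?thesis
    by (auto simp: binary_seq_top_def openin_PiE_gen)
qed

lemma binary_seq_top_cylinder_in_open:
  assumes "openin binary_seq_top U" "x \<in> U"
  obtains N where "{y \<in> topspace binary_seq_top. \<forall>k\<in>{1..N}. y k = x k} \<subseteq> U"
proof -
  obtain V where V: "finite {k \<in> {1..}. V k \<noteq> {0, 1}}" "x \<in> Pi\<^sub>E {1..} V" "Pi\<^sub>E {1..} V \<subseteq> U"
    using assms unfolding binary_seq_top_def openin_product_topology_alt by force
  obtain N where N: "\<And>k. k \<in> {1..} \<Longrightarrow> V k \<noteq> {0, 1} \<Longrightarrow> k \<le> N"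
    using V(1) unfolding finite_nat_set_iff_bounded_le by blast
  have "{y \<in> topspace binary_seq_top. \<forall>k\<in>{1..N}. y k = x k} \<subseteq> Pi\<^sub>E {1..} V"
  proof
    fix y assume y: "y \<in> {y \<in> topspace binary_seq_top. \<forall>k\<in>{1..N}. y k = x k}"
    have "y k \<in> V k" if k: "k \<in> {1..}" for k
    proof (cases "V k = {0, 1}")
      case True
      with y k show ?thesis unfolding topspace_binary_seq_top by (auto simp: PiE_iff)
    next
      case False
      with N k y have "y k = x k" by simp
      with V(2) k show ?thesis by (simp add: PiE_iff)
    qed
    with y show "y \<in> Pi\<^sub>E {1..} V"
      by (simp add: topspace_binary_seq_top PiE_iff)
  qed
  from this V(3) have "{y \<in> topspace binary_seq_top. \<forall>k\<in>{1..N}. y k = x k} \<subseteq> U"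
    by (rule order_trans)
  then show thesis
    by (rule that)
qed

lemma in_binary_seq_top_closure_iff:
  "x \<in> binary_seq_top closure_of S \<longleftrightarrow> x \<in> topspace binary_seq_top \<and>
     (\<forall>N. \<exists>y \<in> S \<inter> topspace binary_seq_top. \<forall>k\<in>{1..N}. y k = x k)"
  (is "_ \<longleftrightarrow> _ \<and> ?R")
proof (cases "x \<in> topspace binary_seq_top")
  case True
  have "?R" if closure: "\<And>U. x \<in> U \<Longrightarrow> openin binary_seq_top U \<Longrightarrow> \<exists>y\<in>S. y \<in> U"
  proof
    fix N
    show "\<exists>y \<in> S \<inter> topspace binary_seq_top. \<forall>k\<in>{1..N}. y k = x k"
      using closure[OF _ openin_binary_seq_top_cylinder[of N x]] True by simp blast
  qed
  moreover have "\<exists>y\<in>S. y \<in> U" if R: ?R and U: "openin binary_seq_top U" "x \<in> U" for U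
  proof -
    obtain N where "{y \<in> topspace binary_seq_top. \<forall>k\<in>{1..N}. y k = x k} \<subseteq> U"
      using binary_seq_top_cylinder_in_open[OF U] .
    with R show ?thesis by blast
  qed
  ultimately show ?thesis
    using True unfolding in_closure_of by metis
qed (simp add: in_closure_of)

theorem corollary4p2:
  fixes B :: "nat set"
  assumes "infinite B"
    and "B \<subseteq> {2..}"
    and "pairwise coprime B"
    and "(\<lambda>b. 1 / real b) summable_on B"
  shows "binary_seq_top closure_of {(shift ^^ n) (eta B) | n. n \<in> {1..}} = admissible_seqs B"
proof (intro equalityI subsetI)
  fix x assume x: "x \<in> binary_seq_top closure_of {(shift ^^ n) (eta B) | n. n \<in> {1..}}"
  let ?A = "{n \<in> {1..}. x n = 1}"
  have "residue_count ?A b < b" if b: "b \<in> B" for b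
  proof (rule ccontr)
    let ?R = "{r \<in> {0..<b}. \<exists>a\<in>?A. [a = r] (mod b)}"
    assume "\<not> ?thesis"
    then have "?R = {0..<b}"
      unfolding residue_count_def by (intro card_seteq) auto
    then have "\<forall>r\<in>{0..<b}. \<exists>a. a \<in> ?A \<and> [a = r] (mod b)"
      by blast
    then obtain f where f: "\<And>r. r < b \<Longrightarrow> f r \<in> ?A" "\<And>r. r < b \<Longrightarrow> [f r = r] (mod b)"
      by (metis atLeastLessThan_iff le0)
    \<comment> \<open>One witness per residue suffices, so a finite window refutes
      admissibility.\<close>
    obtain N where N: "\<And>r. r < b \<Longrightarrow> f r \<le> N"
      using finite_nat_set_iff_bounded_le[of "f ` {..<b}"] by auto
    obtain n where n: "\<And>k. k \<in> {1..N} \<Longrightarrow> (shift ^^ n) (eta B) k = x k"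
      using x unfolding in_binary_seq_top_closure_iff by blast
    have "b > 0" using b assms(2) by fastforce
    \<comment> \<open>\<open>r\<close> is the residue of \<open>- n\<close>. Its witness
      \<open>f r\<close> carries a 1 in \<open>x\<close>, but \<open>b\<close> divides
      \<open>n + f r\<close>, so the shifted \<open>eta B\<close> has a 0 there.\<close>
    define r where "r = (b - 1) * n mod b"
    have r: "r < b" using \<open>b > 0\<close> by (simp add: r_def)
    have "[f r = (b - 1) * n] (mod b)"
      using f(2)[OF r] by (simp add: r_def cong_def)
    then have "[n + f r = n + (b - 1) * n] (mod b)"
      by (simp add: cong_add_lcancel_nat)
    also have "n + (b - 1) * n = b * n"
      using \<open>b > 0\<close> by (cases b) auto
    finally have "b dvd n + f r"
      by (metis cong_dvd_iff dvd_triv_left)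
    with b f(1)[OF r] have "(shift ^^ n) (eta B) (f r) = 0"
      by (auto simp: shift_funpow_eta)
    with f(1)[OF r] n[of "f r"] N[OF r] show False
      by simp
  qed
  with x show "x \<in> admissible_seqs B"
    by (auto simp: admissible_seqs_def admissible_set_def in_closure_of)
next
  fix x assume "x \<in> admissible_seqs B"
  then have x: "x \<in> topspace binary_seq_top" and adm: "admissible_set B {n \<in> {1..}. x n = 1}"
    by (auto simp: admissible_seqs_def)
  have "\<exists>n \<ge> 1. \<forall>k\<in>{1..N}. (shift ^^ n) (eta B) k = x k" for N
  proof -
    obtain n where n: "n \<ge> 1"
      "\<And>j. j \<in> {1..N} \<Longrightarrow> (\<exists>b\<in>B. b dvd n + j) \<longleftrightarrow> j \<notin> {n \<in> {1..}. x n = 1}"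
      using admissible_pattern_occurs[OF assms adm] by blast
    have "(shift ^^ n) (eta B) k = x k" if k: "k \<in> {1..N}" for k
    proof -
      have "x k \<in> {0, 1}"
        using x k by (auto simp: topspace_binary_seq_top PiE_iff)
      then show ?thesis
        using n(2)[OF k] k by (auto simp: shift_funpow_eta)
    qed
    with n(1) show ?thesis by blast
  qed
  moreover have "(shift ^^ n) (eta B) \<in> topspace binary_seq_top" for n
    by (auto simp: shift_funpow_eta topspace_binary_seq_top)
  ultimately show "x \<in> binary_seq_top closure_of {(shift ^^ n) (eta B) | n. n \<in> {1..}}"
    unfolding in_binary_seq_top_closure_iff using x by fastforce
qed

end
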